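(* Let $\xi$ be a random vector taking values in $\{0,1\}^m$, let $\epsilon$ be a given confidence parameter (typically near zero), and let $$\mathcal{X}=\{v\in\{0,1\}^m : \mathbb{P}\{v\ge\xi\}\ge 1-\epsilon\}.$$ Then the maximal clique inequalities are facet-defining for $\operatorname{conv}(\mathcal{X})$; that is, for every maximal clique, with vertex set $\mathcal{Q}\subseteq[m]$, of the two-cover induced graph $G$ of $\mathcal{X}$, the inequality $$\sum_{k\in\mathcal{Q}}v_k\ \ge\ |\mathcal{Q}|-1$$ is facet-defining for $\operatorname{conv}(\mathcal{X})$.
   Context: $[m]=\{1,\dots,m\}$ and vector inequalities are componentwise. For $\mathcal{C}\subseteq[m]$, $\xi_{\mathcal{C}}$ is the subvector of $\xi$ indexed by $\mathcal{C}$, and $$\lambda(\mathcal{C})=\mathbb{P}\{\boldsymbol{0}\not\ge\xi_{\mathcal{C}}\},$$ i.e. the probability that $\xi_k=1$ for at least one $k\in\mathcal{C}$. A subset $\mathcal{C}\subseteq[m]$ is a cover for $\mathcal{X}$ if $\lambda(\mathcal{C})>\epsilon$; it is minimal if and only if $\lambda(\mathcal{C}\setminus\{k\})\le\epsilon$ for all $k\in\mathcal{C}$. A minimal cover of size 2 is called a two-cover. The two-cover induced graph is the graph $G=([m],\mathcal{E})$ which, for distinct $j,k\in[m]$, contains the edge $\{j,k\}$ if and only if $\lambda(\{j,k\})>\epsilon$. A clique with vertex set $\mathcal{Q}$ is a fully connected subgraph of $G$, i.e. $\{j,k\}\in\mathcal{E}$ for any $j\in\mathcal{Q}$ and $k\in\mathcal{Q}\setminus\{j\}$;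 a maximal clique is a clique in $G$ that cannot be extended by including any more vertices. The maximal clique inequality associated with a maximal clique with vertex set $\mathcal{Q}$ is $\sum_{k\in\mathcal{Q}}v_k\ge|\mathcal{Q}|-1$. An inequality is facet-defining for a polytope $P$ if it is valid for $P$ and the set of points of $P$ satisfying it with equality is a face of dimension $\dim P-1$. *)

theory Defs
  imports "HOL-Probability.Probability" "HOL-Library.Ramsey"
begin

text \<open>The index set [m] is the universe of the finite type \<open>'m\<close>; the order on
  \<^typ>\<open>real ^ 'm\<close> is the componentwise one.\<close>

definition binary_vectors :: "(real ^ 'm) set" where
  "binary_vectors = {v. \<forall>k. v $ k \<in> {0, 1}}"

definition chance_set :: "'a measure \<Rightarrow> ('a \<Rightarrow> real ^ 'm) \<Rightarrow> real \<Rightarrow> (real ^ 'm) set" where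
  "chance_set M \<xi> \<epsilon> =
     {v \<in> binary_vectors. measure M {\<omega> \<in> space M. v \<ge> \<xi> \<omega>} \<ge> 1 - \<epsilon>}"

definition violation_prob :: "'a measure \<Rightarrow> ('a \<Rightarrow> real ^ 'm) \<Rightarrow> 'm set \<Rightarrow> real" where
  "violation_prob M \<xi> C = measure M {\<omega> \<in> space M. \<not> (\<forall>k\<in>C. 0 \<ge> \<xi> \<omega> $ k)}"

text \<open>Singletons may themselves be covers, so an edge is any pair that is a cover, whether or
  not it is a minimal one.\<close>

definition two_cover_edges :: "'a measure \<Rightarrow> ('a \<Rightarrow> real ^ 'm) \<Rightarrow> real \<Rightarrow> 'm set set" where
  "two_cover_edges M \<xi> \<epsilon> = {{j, k} | j k. j \<noteq> k \<and> violation_prob M \<xi> {j, k} > \<epsilon>}"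

definition maximal_clique :: "'m set \<Rightarrow> 'm set set \<Rightarrow> bool" where
  "maximal_clique Q E \<longleftrightarrow> clique Q E \<and> (\<forall>Q'. Q \<subset> Q' \<longrightarrow> \<not> clique Q' E)"

text \<open>The inequality \<open>f x \<ge> b\<close>, with \<open>f\<close> linear, is facet-defining for \<open>P\<close>. In contrast to
  \<^const>\<open>facet_of\<close>, the face may be empty, with dimension -1, when \<open>P\<close> is a single point.
  This occurs for the convex hull of \<^const>\<open>chance_set\<close> when every singleton is a cover: then
  only the all-ones vector is feasible.\<close>

definition facet_defining :: "('v::euclidean_space) set \<Rightarrow> ('v \<Rightarrow> real) \<Rightarrow> real \<Rightarrow> bool" where
  "facet_defining P f b \<longleftrightarrow>
     (\<forall>x\<in>P. f x \<ge> b) \<and>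
     {x \<in> P. f x = b} face_of P \<and>
     aff_dim {x \<in> P. f x = b} = aff_dim P - 1"

end

theory Submission
  imports Defs
begin

text \<open>
  A binary vector \<open>v\<close> is feasible exactly when its zero set \<open>C\<close> is not a cover, so the feasible
  vectors correspond to the sets \<open>C\<close> with \<open>violation_prob M \<xi> C \<le> \<epsilon>\<close>
  (\<open>chance_set_eq_zero_at_image\<close>), a family closed under subsets. If \<open>Q\<close> is a clique, such a
  \<open>C\<close> contains at most one vertex of \<open>Q\<close>, since any two are joined by an edge and hence form a
  cover. This is the validity of the clique inequality, and equality holds precisely when
  \<open>C\<close> meets \<open>Q\<close>.

  For the dimension, affinely independent points need not be counted. Write \<open>\<one>\<close> for the
  all-ones vector; it is feasible and violates the equation by one. It therefore suffices that
  \<open>\<one>\<close> together with the tight feasible points affinely spans the feasible set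
  (\<open>facet_defining_convex_hullI\<close>): adjoining a point off the hyperplane raises the dimension of the
  face by exactly one. The point \<open>\<one> - e\<^sub>k\<close> of a non-cover \<open>{k}\<close> is itself tight if \<open>k \<in> Q\<close>. If
  \<open>k \<notin> Q\<close>, maximality of \<open>Q\<close> supplies \<open>j \<in> Q\<close> for which \<open>{j, k}\<close> is not a cover, and
  \<open>\<one> - e\<^sub>k = \<one> + (\<one> - e\<^sub>j - e\<^sub>k) - (\<one> - e\<^sub>j)\<close> is an affine combination of \<open>\<one>\<close> and two tight
  points. A general feasible point \<open>\<one> - (\<Sum>k\<in>C. e\<^sub>k)\<close> is an affine combination of \<open>\<one>\<close> and the
  points \<open>\<one> - e\<^sub>k\<close> for \<open>k \<in> C\<close>. The degenerate case in which every singleton is a cover and the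
  face is empty is covered by the same argument.
\<close>

definition zero_at :: "'m set \<Rightarrow> real ^ 'm" where
  "zero_at C = (\<chi> k. if k \<in> C then 0 else 1)"

lemma zero_at_nth [simp]: "zero_at C $ k = (if k \<in> C then 0 else 1)"
  by (simp add: zero_at_def)

lemma binary_vectors_eq_range_zero_at: "binary_vectors = range zero_at"
proof
  show "binary_vectors \<subseteq> range (zero_at :: 'm set \<Rightarrow> real ^ 'm)"
  proof
    fix v :: "real ^ 'm"
    assume "v \<in> binary_vectors"
    then have "v = zero_at {k. v $ k = 0}"
      by (auto simp: binary_vectors_def vec_eq_iff)
    then show "v \<in> range zero_at" by blast
  qed
qed (auto simp: binary_vectors_def split: if_splits)

lemma sum_zero_at:
  "(\<Sum>k\<in>Q. zero_at C $ k) = real (card Q) - real (card (Q \<inter> C))" for Q C :: "'m::finite set"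
proof -
  have "(\<Sum>k\<in>Q. zero_at C $ k) = (\<Sum>k\<in>Q. 1 - (if k \<in> C then 1 else 0))"
    by (rule sum.cong) auto
  also have "\<dots> = real (card Q) - real (card (Q \<inter> C))"
    by (simp add: sum_subtractf sum.If_cases Int_def)
  finally show ?thesis .
qed

lemma chance_event_sets:
  fixes \<xi> :: "'a \<Rightarrow> real ^ 'm"
  assumes "\<xi> \<in> borel_measurable M"
  shows "{\<omega> \<in> space M. \<not> (\<forall>k\<in>C. 0 \<ge> \<xi> \<omega> $ k)} \<in> sets M"
proof -
  have [measurable]: "(\<lambda>\<omega>. \<xi> \<omega> $ k) \<in> borel_measurable M" for k
    by (rule borel_measurable_continuous_on[OF _ assms]) (intro continuous_intros)
  have [measurable]: "finite C" by simp
  show ?thesis by measurable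
qed

text \<open>For a binary \<open>\<xi>\<close>, the constraint \<open>v \<ge> \<xi>\<close> can fail only in coordinates where \<open>v\<close> vanishes, so
  its failure probability is that of the zero set of \<open>v\<close>.\<close>

lemma chance_set_eq_zero_at_image:
  fixes \<xi> :: "'a \<Rightarrow> real ^ 'm"
  assumes "prob_space M" and "\<xi> \<in> borel_measurable M"
    and bin: "\<And>\<omega>. \<omega> \<in> space M \<Longrightarrow> \<xi> \<omega> \<in> binary_vectors"
  shows "chance_set M \<xi> \<epsilon> = zero_at ` {C. violation_prob M \<xi> C \<le> \<epsilon>}"
proof -
  interpret prob_space M by fact
  have "measure M {\<omega> \<in> space M. zero_at C \<ge> \<xi> \<omega>} = 1 - violation_prob M \<xi> C" for C
  proof -
    let ?V = "{\<omega> \<in> space M. \<not> (\<forall>k\<in>C. 0 \<ge> \<xi> \<omega> $ k)}"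
    have "\<xi> \<omega> \<le> zero_at C \<longleftrightarrow> (\<forall>k\<in>C. \<xi> \<omega> $ k \<le> 0)" if "\<omega> \<in> space M" for \<omega>
    proof -
      have "\<xi> \<omega> $ k \<le> 1" for k
        using bin[OF that] unfolding binary_vectors_def
        by (smt (verit) insert_iff mem_Collect_eq singletonD)
      then show ?thesis by (auto simp: less_eq_vec_def)
    qed
    then have "{\<omega> \<in> space M. zero_at C \<ge> \<xi> \<omega>} = space M - ?V"
      by auto
    then show ?thesis
      using prob_compl[OF chance_event_sets[OF assms(2)], of C] by (simp add: violation_prob_def)
  qed
  then show ?thesis
    unfolding chance_set_def binary_vectors_eq_range_zero_at by auto
qed

lemma violation_prob_mono:
  fixes \<xi> :: "'a \<Rightarrow> real ^ 'm"
  assumes "prob_space M" and "\<xi> \<in> borel_measurable M" and "C \<subseteq> D"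
  shows "violation_prob M \<xi> C \<le> violation_prob M \<xi> D"
proof -
  interpret prob_space M by fact
  show ?thesis
    unfolding violation_prob_def
    using assms(3) by (intro finite_measure_mono chance_event_sets[OF assms(2)]) auto
qed

lemma two_cover_edges_iff:
  assumes "j \<noteq> k"
  shows "{j, k} \<in> two_cover_edges M \<xi> \<epsilon> \<longleftrightarrow> \<epsilon> < violation_prob M \<xi> {j, k}"
  using assms unfolding two_cover_edges_def by (auto simp: doubleton_eq_iff insert_commute)

lemma maximal_clique_obtain_nonneighbour:
  assumes "maximal_clique Q E" and "k \<notin> Q"
  obtains j where "j \<in> Q" and "{j, k} \<notin> E"
proof -
  have "clique Q E" and "\<not> clique (insert k Q) E"
    using assms unfolding maximal_clique_def by blast+
  then show ?thesis
    using that unfolding clique_def by (metis insert_commute insert_iff)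
qed

lemma affine_add_diff_mem:
  assumes "affine A" and "x \<in> A" and "y \<in> A" and "z \<in> A"
  shows "x + y - z \<in> A"
  using mem_affine_3[OF assms, of 1 1 "-1"] by simp

text \<open>A point \<open>p\<close> off the hyperplane raises the dimension of the tight points by exactly one, so the
  dimension formula for a facet reduces to a spanning statement about generators.\<close>

lemma facet_defining_convex_hullI:
  fixes X :: "'v::euclidean_space set"
  assumes valid: "\<And>x. x \<in> X \<Longrightarrow> b \<le> a \<bullet> x"
    and "p \<in> X" and off: "a \<bullet> p \<noteq> b"
    and span: "X \<subseteq> affine hull (insert p {x \<in> X. a \<bullet> x = b})"
  shows "facet_defining (convex hull X) (\<lambda>x. a \<bullet> x) b"
proof -
  let ?P = "convex hull X"
  let ?T = "{x \<in> ?P. a \<bullet> x = b}"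
  have "?P \<subseteq> {x. a \<bullet> x \<ge> b}"
    using valid by (intro hull_minimal) (auto simp: convex_halfspace_ge)
  then have valid': "\<forall>x\<in>?P. b \<le> a \<bullet> x" by blast
  have "?P \<inter> {x. a \<bullet> x = b} face_of ?P"
    using valid' by (intro face_of_Int_supporting_hyperplane_ge) auto
  then have face: "?T face_of ?P" by (simp add: Int_def)
  have "affine hull ?T \<subseteq> {x. a \<bullet> x = b}"
    by (intro hull_minimal) (auto simp: affine_hyperplane)
  then have "p \<notin> affine hull ?T" using off by blast
  then have dim_insert: "aff_dim (insert p ?T) = aff_dim ?T + 1"
    by (simp add: aff_dim_insert)
  have "affine hull (insert p {x \<in> X. a \<bullet> x = b}) \<subseteq> affine hull (insert p ?T)"
    by (intro hull_mono) (auto intro: hull_inc)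
  then have "?P \<subseteq> affine hull (insert p ?T)"
    using span by (intro hull_minimal) (auto intro: affine_imp_convex)
  then have "aff_dim ?P \<le> aff_dim (insert p ?T)"
    by (metis aff_dim_subset aff_dim_affine_hull)
  moreover have "aff_dim (insert p ?T) \<le> aff_dim ?P"
    using \<open>p \<in> X\<close> by (intro aff_dim_subset) (auto intro: hull_inc)
  ultimately show ?thesis
    using valid' face dim_insert unfolding facet_defining_def by simp
qed

theorem corollary4p4:
  fixes M :: "'a measure" and \<xi> :: "'a \<Rightarrow> real ^ 'm" and \<epsilon> :: real
  assumes "prob_space M"
    and "\<xi> \<in> borel_measurable M"
    and "\<And>\<omega>. \<omega> \<in> space M \<Longrightarrow> \<xi> \<omega> \<in> binary_vectors"
    and "0 \<le> \<epsilon>"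
  shows "\<forall>Q :: 'm set. maximal_clique Q (two_cover_edges M \<xi> \<epsilon>) \<longrightarrow>
    facet_defining (convex hull (chance_set M \<xi> \<epsilon>)) (\<lambda>v. \<Sum>k\<in>Q. v $ k) (real (card Q) - 1)"
proof (intro allI impI)
  fix Q :: "'m set"
  assume max: "maximal_clique Q (two_cover_edges M \<xi> \<epsilon>)"
  let ?prob = "violation_prob M \<xi>"
  let ?X = "chance_set M \<xi> \<epsilon>"
  let ?one = "zero_at {} :: real ^ 'm"
  define a :: "real ^ 'm" where "a = (\<chi> k. if k \<in> Q then 1 else 0)"
  have a: "a \<bullet> v = (\<Sum>k\<in>Q. v $ k)" for v
    by (simp add: a_def inner_vec_def if_distrib[of "\<lambda>x. x * _"] sum.If_cases cong: if_cong)
  have X: "?X = zero_at ` {C. ?prob C \<le> \<epsilon>}"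
    by (rule chance_set_eq_zero_at_image[OF assms(1-3)])
  note mono = violation_prob_mono[OF assms(1,2)]
  let ?T = "{v \<in> ?X. a \<bullet> v = real (card Q) - 1}"
  have tight: "zero_at C \<in> ?T" if "?prob C \<le> \<epsilon>" and "card (Q \<inter> C) = 1" for C
    using that by (auto simp: X a sum_zero_at simp del: zero_at_nth)
  have "real (card Q) - 1 \<le> a \<bullet> v" if v: "v \<in> ?X" for v
  proof -
    have "v \<in> zero_at ` {C. ?prob C \<le> \<epsilon>}" using v by (simp only: X)
    then obtain C where C: "v = zero_at C" "?prob C \<le> \<epsilon>" by blast
    have "j = k" if jk: "j \<in> Q \<inter> C" "k \<in> Q \<inter> C" for j k
    proof (rule ccontr)
      assume "j \<noteq> k"
      then have "\<epsilon> < ?prob {j, k}"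
        using max jk two_cover_edges_iff unfolding maximal_clique_def clique_def by blast
      also have "\<dots> \<le> ?prob C" using jk by (intro mono) auto
      finally show False using C by simp
    qed
    then have "card (Q \<inter> C) \<le> 1" by (auto simp: card_le_Suc0_iff_eq)
    then show ?thesis by (simp add: C a sum_zero_at del: zero_at_nth)
  qed
  moreover have "?one \<in> ?X"
    using \<open>0 \<le> \<epsilon>\<close> by (auto simp: X violation_prob_def)
  moreover have "a \<bullet> ?one \<noteq> real (card Q) - 1"
    by (simp add: a sum_zero_at del: zero_at_nth)
  moreover have "?X \<subseteq> affine hull (insert ?one ?T)"
  proof -
    define A where "A = affine hull (insert ?one ?T)"
    have aff: "affine A" and one: "?one \<in> A" and TA: "?T \<subseteq> A"
      unfolding A_def by (auto intro: hull_inc)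
    have singleton: "zero_at {k} \<in> A" if k: "?prob {k} \<le> \<epsilon>" for k
    proof (cases "k \<in> Q")
      case True
      then show ?thesis using tight[OF k] TA by auto
    next
      case False
      then obtain j where j: "j \<in> Q" "{j, k} \<notin> two_cover_edges M \<xi> \<epsilon>"
        using maximal_clique_obtain_nonneighbour[OF max] by blast
      with False have jk: "?prob {j, k} \<le> \<epsilon>"
        using two_cover_edges_iff[of j k] by fastforce
      moreover have "?prob {j} \<le> ?prob {j, k}" by (rule mono) auto
      ultimately have "zero_at {j, k} \<in> A" "zero_at {j} \<in> A"
        using tight[of "{j, k}"] tight[of "{j}"] j False TA by auto
      from affine_add_diff_mem[OF aff one this]
      have "?one + zero_at {j, k} - zero_at {j} \<in> A" .
      also have "?one + zero_at {j, k} - zero_at {j} = zero_at {k}"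
        using j False by (auto simp: vec_eq_iff)
      finally show ?thesis .
    qed
    have "zero_at C \<in> A" if "?prob C \<le> \<epsilon>" for C
      using finite[of C] that
    proof (induction C rule: finite_induct)
      case empty
      show ?case by (rule one)
    next
      case (insert k C)
      have "?prob C \<le> \<epsilon>" and "?prob {k} \<le> \<epsilon>"
        using order_trans[OF mono insert.prems] by auto
      then have "zero_at C + zero_at {k} - ?one \<in> A"
        using affine_add_diff_mem[OF aff _ _ one] insert.IH singleton by blast
      also have "zero_at C + zero_at {k} - ?one = zero_at (insert k C)"
        using insert.hyps by (auto simp: vec_eq_iff)
      finally show ?case .
    qed
    then show ?thesis unfolding A_def[symmetric] by (auto simp: X)
  qed
  ultimately have "facet_defining (convex hull ?X) (\<lambda>v. a \<bullet> v) (real (card Q) - 1)"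
    by (rule facet_defining_convex_hullI)
  then show "facet_defining (convex hull ?X) (\<lambda>v. \<Sum>k\<in>Q. v $ k) (real (card Q) - 1)"
    by (simp add: a)
qed

end
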